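(* Assume: (A1) $\mathcal{X}$ is compact. (A2) For $\mathbb{P}_Z$-a.e. $z\in\mathcal{Z}$ and every $x\in\mathcal{X}$: $\mathbb{E}_{\mathbb{P}(z)}|f(x,\xi)|<\infty$, and the conditional $\tau$-quantile $Q_\tau(x;z)$ is finite and unique (i.e. $u\mapsto \mathbb{E}_{\mathbb{P}(z)}[\rho_\tau(f(x,\xi)-u)]$ has a unique minimizer over $\mathbb{R}$). (A3) For $\mathbb{P}_Z$-a.e. $z\in\mathcal{Z}$: there exist $\alpha>0$ and $L_1>0$ such that $|Q_\tau(x_1;z)-Q_\tau(x_2;z)|\le L_1\|x_1-x_2\|^\alpha$ for all $x_1,x_2\in\mathcal{X}$; and there exist $\beta>0$ and $L_2>0$, independent of the data $\mathcal{D}_N$ (the same for every $N$ and every data realization), such that $|\widehat{Q}^N_\tau(x_1;z)-\widehat{Q}^N_\tau(x_2;z)|\le L_2\|x_1-x_2\|^\beta$ for all $x_1,x_2\in\mathcal{X}$. (A4) For $\mathbb{P}_Z$-a.e. $z\in\mathcal{Z}$: (a) there exists a compact set $B_z\subseteq\Xi$ with $\mathbb{P}(\xi\in B_z\mid Z=z)>0$; (b) for any $x\in\mathcal{X}$ and $u\in\mathbb{R}$, $\mathbb{E}_{\widehat{\mathbb{P}}_N(z)}[\rho_\tau(f(x,\xi)-u)]\to\mathbb{E}_{\mathbb{P}(z)}[\rho_\tau(f(x,\xi)-u)]$ in probability as $N\to\infty$; (c) for any measurable set $A\subseteq\Xi$, $\mathbb{E}_{\widehat{\mathbb{P}}_N(z)}(\mathbf{1}_A)\to\mathbb{E}_{\mathbb{P}(z)}(\mathbf{1}_A)$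 in probability as $N\to\infty$. Then, for $\mathbb{P}_Z$-a.e. $z\in\mathcal{Z}$, in probability as $N\to\infty$: (i) $\widehat{v}^N(z)\to v^\star(z)$; (ii) $\sup_{x\in\widehat{\mathcal{X}}^N(z)}Q_\tau(x;z)\to v^\star(z)$; (iii) $D(\widehat{\mathcal{X}}^N(z),\mathcal{X}^\star(z))\to 0$.
   Context: Let $\mathcal{X}\subseteq\mathbb{R}^n$ be the (nonempty) first-stage feasible set and $\tau\in(0,1)$. $\xi$ is a random vector with support $\Xi\subseteq\mathbb{R}^\ell$, and $Z$ is a random vector with support $\mathcal{Z}\subseteq\mathbb{R}^p$ and distribution $\mathbb{P}_Z$; $\mathbb{P}(z)$ denotes the conditional distribution of $\xi$ given $Z=z$. For fixed matrices $T,W,C$ and vectors $h$, $q\in\mathbb{R}^m$ of compatible dimensions, $$f(x,\xi)=\min_{y\in\mathbb{R}^m}\{q^\top y \mid Tx+Wy+C\xi\ge h,\ y\ge 0\},$$ and it is a standing assumption that for all $x\in\mathcal{X}$, $\xi\in\Xi$ this linear program has an optimal solution and $f(x,\xi)>0$. The check loss is $\rho_\tau(u)=u(\tau-\mathbf{1}(u<0))$. The conditional quantile is $Q_\tau(x;z)=\inf\{t\in\mathbb{R}\mid \mathbb{P}(f(x,\xi)\le t\mid Z=z)\ge\tau\}$; equivalently it is the (smallest) minimizer over $u\in\mathbb{R}$ of $\mathbb{E}_{\mathbb{P}(z)}[\rho_\tau(f(x,\xi)-u)]$. $(Z^1,\xi^1),(Z^2,\xi^2),\dots$ is a sequence of samples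 of $(Z,\xi)$ and $\mathcal{D}_N=\{(Z^i,\xi^i)\}_{i=1}^N$. For each $N$ and $z$, $\widehat{\mathbb{P}}_N(z)$ is a data-dependent (determined by $\mathcal{D}_N$) probability distribution on $\Xi$ serving as an estimate of $\mathbb{P}(z)$, for which the expectations used are well-defined and finite. The estimated conditional quantile $\widehat{Q}^N_\tau(x;z)$ is the minimizer over $u\in\mathbb{R}$ of $\mathbb{E}_{\widehat{\mathbb{P}}_N(z)}[\rho_\tau(f(x,\xi)-u)]$, the smallest one if not unique. Convergence in probability is with respect to the randomness of the data. The true problem is $v^\star(z)=\min_{x\in\mathcal{X}}Q_\tau(x;z)$ with set of optimal solutions $\mathcal{X}^\star(z)$; the sample problem is $\widehat{v}^N(z)=\min_{x\in\mathcal{X}}\widehat{Q}^N_\tau(x;z)$ with set of optimal solutions $\widehat{\mathcal{X}}^N(z)$. For sets $\mathcal{S}_1,\mathcal{S}_2$, $D(\mathcal{S}_1,\mathcal{S}_2)=\sup_{s_1\in\mathcal{S}_1}\inf_{s_2\in\mathcal{S}_2}\|s_1-s_2\|$, with $\|\cdot\|$ the Euclidean norm. *)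

theory Defs
  imports "HOL-Probability.Probability"
begin

definition measure_support :: "'a::topological_space measure \<Rightarrow> 'a set" where
  "measure_support \<mu> = {x. \<forall>U. open U \<and> x \<in> U \<longrightarrow> 0 < emeasure \<mu> U}"

text \<open>A (regular) conditional distribution \<open>\<kappa>\<close> of \<open>\<xi>\<close> given \<open>Z\<close>.\<close>
definition is_cond_distribution ::
  "'a measure \<Rightarrow> ('a \<Rightarrow> 'z::topological_space) \<Rightarrow> ('a \<Rightarrow> 'x::topological_space) \<Rightarrow>
    ('z \<Rightarrow> 'x measure) \<Rightarrow> bool" where
  "is_cond_distribution P Z \<xi> \<kappa> \<longleftrightarrow>
     \<kappa> \<in> borel \<rightarrow>\<^sub>M prob_algebra borel \<and>
     (\<forall>A\<in>sets borel. \<forall>B\<in>sets borel.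
        emeasure P {\<omega> \<in> space P. Z \<omega> \<in> A \<and> \<xi> \<omega> \<in> B}
          = (\<integral>\<^sup>+ z\<in>A. emeasure (\<kappa> z) B \<partial>distr P borel Z))"

text \<open>
  Convergence in probability to a constant, with outer probabilities, so that no measurability has
  to be presupposed (for a non-measurable event, \<^const>\<open>measure\<close> would silently be 0).
  For random variables it is the usual notion, see the lemma below.
\<close>
definition tendsto_in_prob :: "'w measure \<Rightarrow> (nat \<Rightarrow> 'w \<Rightarrow> real) \<Rightarrow> real \<Rightarrow> bool" where
  "tendsto_in_prob M X c \<longleftrightarrow>
     (\<forall>\<epsilon>>0. (\<lambda>N. outer_measure_of M {\<omega> \<in> space M. \<bar>X N \<omega> - c\<bar> > \<epsilon>}) \<longlonglongrightarrow> 0)"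

lemma tendsto_in_prob_random_variables:
  assumes "prob_space M" and [measurable]: "\<And>N. X N \<in> borel_measurable M"
  shows "tendsto_in_prob M X c \<longleftrightarrow>
           (\<forall>\<epsilon>>0. (\<lambda>N. measure M {\<omega> \<in> space M. \<bar>X N \<omega> - c\<bar> > \<epsilon>}) \<longlonglongrightarrow> 0)"
proof -
  interpret prob_space M by fact
  have "outer_measure_of M {\<omega> \<in> space M. \<bar>X N \<omega> - c\<bar> > \<epsilon>}
          = ennreal (measure M {\<omega> \<in> space M. \<bar>X N \<omega> - c\<bar> > \<epsilon>})" for N \<epsilon>
    by (subst outer_measure_of_eq) (auto simp: emeasure_eq_measure)
  then show ?thesis
    unfolding tendsto_in_prob_def by (simp add: ennreal_tendsto_0_iff)
qed

definition recourse_feasible ::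
  "real^'n^'r \<Rightarrow> real^'m^'r \<Rightarrow> real^'l^'r \<Rightarrow> real^'r \<Rightarrow> real^'n \<Rightarrow> real^'l \<Rightarrow> (real^'m) set" where
  "recourse_feasible T W C h x \<xi> = {y. T *v x + W *v y + C *v \<xi> \<ge> h \<and> y \<ge> 0}"

definition recourse_optimal ::
  "real^'m \<Rightarrow> real^'n^'r \<Rightarrow> real^'m^'r \<Rightarrow> real^'l^'r \<Rightarrow> real^'r \<Rightarrow> real^'n \<Rightarrow> real^'l
    \<Rightarrow> (real^'m) set" where
  "recourse_optimal q T W C h x \<xi> =
     {y. is_arg_min (\<lambda>y. q \<bullet> y) (\<lambda>y. y \<in> recourse_feasible T W C h x \<xi>) y}"

text \<open>The infimum is a minimum exactly when \<^const>\<open>recourse_optimal\<close> is nonempty.\<close>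
definition recourse_cost ::
  "real^'m \<Rightarrow> real^'n^'r \<Rightarrow> real^'m^'r \<Rightarrow> real^'l^'r \<Rightarrow> real^'r \<Rightarrow> real^'n \<Rightarrow> real^'l \<Rightarrow> real" where
  "recourse_cost q T W C h x \<xi> = (INF y\<in>recourse_feasible T W C h x \<xi>. q \<bullet> y)"

definition check_loss :: "real \<Rightarrow> real \<Rightarrow> real" where
  "check_loss \<tau> u = u * (\<tau> - of_bool (u < 0))"

definition expected_check_loss :: "real \<Rightarrow> 'x measure \<Rightarrow> ('x \<Rightarrow> real) \<Rightarrow> real \<Rightarrow> real" where
  "expected_check_loss \<tau> \<mu> g u = (\<integral>\<xi>. check_loss \<tau> (g \<xi> - u) \<partial>\<mu>)"

definition quantile :: "real \<Rightarrow> 'x measure \<Rightarrow> ('x \<Rightarrow> real) \<Rightarrow> real" where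
  "quantile \<tau> \<mu> g = Inf {t. measure \<mu> {\<xi> \<in> space \<mu>. g \<xi> \<le> t} \<ge> \<tau>}"

definition estimated_quantile :: "real \<Rightarrow> 'x measure \<Rightarrow> ('x \<Rightarrow> real) \<Rightarrow> real" where
  "estimated_quantile \<tau> \<mu> g =
     (LEAST u. is_arg_min (expected_check_loss \<tau> \<mu> g) (\<lambda>_. True) u)"

definition opt_value :: "'a set \<Rightarrow> ('a \<Rightarrow> real) \<Rightarrow> real" where
  "opt_value X g = (INF x\<in>X. g x)"

definition opt_solutions :: "'a set \<Rightarrow> ('a \<Rightarrow> real) \<Rightarrow> 'a set" where
  "opt_solutions X g = {x. is_arg_min g (\<lambda>x. x \<in> X) x}"

text \<open>The one-sided distance \<open>D(S, S')\<close>; \<^const>\<open>Sup\<close> and \<^const>\<open>Inf\<close> on the reals are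
  meaningful here for nonempty bounded sets.\<close>
definition set_deviation :: "'a::real_normed_vector set \<Rightarrow> 'a set \<Rightarrow> real" where
  "set_deviation S S' = (SUP s\<in>S. INF s'\<in>S'. norm (s - s'))"

text \<open>The data set \<open>[(Z\<^sup>1, \<xi>\<^sup>1), \<dots>, (Z\<^sup>N, \<xi>\<^sup>N)]\<close> at the outcome \<open>\<omega>\<close>.\<close>
definition sample_data :: "(nat \<Rightarrow> 'w \<Rightarrow> 'z) \<Rightarrow> (nat \<Rightarrow> 'w \<Rightarrow> 'x) \<Rightarrow> nat \<Rightarrow> 'w \<Rightarrow> ('z \<times> 'x) list" where
  "sample_data Zs \<xi>s N \<omega> = map (\<lambda>i. (Zs i \<omega>, \<xi>s i \<omega>)) [1..<Suc N]"

end

theory Submission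
  imports Defs
begin

text \<open>
  The secant slope of the expected check loss \<open>G\<close> over \<open>[s, t]\<close> lies between \<open>F(s) - \<tau>\<close> and
  \<open>F(t) - \<tau>\<close>, \<open>F\<close> being the distribution function; hence a unique minimizer of \<open>G\<close> is the quantile.
  The estimated loss \<open>G\<^sub>N\<close> is convex, so if it is close to \<open>G\<close> at the three points \<open>u - \<epsilon>\<close>, \<open>u\<close>,
  \<open>u + \<epsilon>\<close>, where \<open>u\<close> is the minimizer of \<open>G\<close>, then all its minimizers lie in \<open>[u - \<epsilon>, u + \<epsilon>]\<close>.
  This gives convergence in probability of the estimated quantiles for each \<open>x\<close>, which the common
  Hoelder modulus and a finite net of \<open>X\<close> make uniform in \<open>x\<close>. A uniform perturbation of a continuous
  function on a compact set changes its minimum and its minimizers only little. For each error bound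
  only finitely many convergences in probability are used, so outer probabilities suffice.
\<close>

section \<open>Convergence in outer probability\<close>

text \<open>Measurable covers that attain the outer measures turn the induction step into
  subadditivity of \<open>emeasure\<close>.\<close>

lemma outer_measure_of_UN_le:
  assumes "finite I"
  shows "outer_measure_of M (\<Union>i\<in>I. A i) \<le> (\<Sum>i\<in>I. outer_measure_of M (A i))"
  using assms
proof (induction I)
  case empty
  then show ?case by simp
next
  case (insert i I)
  show ?case
  proof (cases "A i \<subseteq> space M \<and> (\<Union>i\<in>I. A i) \<subseteq> space M")
    case True
    obtain E where E: "E \<in> sets M" "A i \<subseteq> E" "outer_measure_of M (A i) = emeasure M E"
      using outer_measure_of_attain True by metis
    obtain F where F: "F \<in> sets M" "(\<Union>i\<in>I. A i) \<subseteq> F"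
      "outer_measure_of M (\<Union>i\<in>I. A i) = emeasure M F"
      using outer_measure_of_attain True by metis
    have "outer_measure_of M (\<Union>i\<in>insert i I. A i) \<le> outer_measure_of M (E \<union> F)"
      using E F by (intro outer_measure_of_mono) auto
    also have "\<dots> \<le> emeasure M E + emeasure M F"
      using E F by (simp add: emeasure_subadditive)
    also have "\<dots> \<le> outer_measure_of M (A i) + (\<Sum>i\<in>I. outer_measure_of M (A i))"
      using E F insert.IH by (simp add: add_left_mono)
    finally show ?thesis using insert by simp
  next
    case False
    \<comment> \<open>A set that leaves the space has no measurable superset, so its outer measure
      is an infimum over the empty set, hence \<open>top\<close>, and the right-hand side is
      infinite.\<close>
    then obtain j where j: "j \<in> insert i I" "\<not> A j \<subseteq> space M" by auto
    then have empty: "{B \<in> sets M. A j \<subseteq> B} = {}"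
      using sets.sets_into_space by blast
    have "outer_measure_of M (A j) = top"
      unfolding outer_measure_of_def empty by simp
    moreover have "outer_measure_of M (A j) \<le> (\<Sum>i\<in>insert i I. outer_measure_of M (A i))"
      using j insert.hyps(1) by (intro member_le_sum) auto
    ultimately show ?thesis by (metis top.extremum_uniqueI top_greatest)
  qed
qed

text \<open>The event that \<open>Y\<close> is off by more than \<open>\<epsilon>\<close> is covered
  by finitely many events in which some \<open>X N i\<close> is off by more than
  \<open>\<delta>\<close>, and their outer measures vanish in the limit. The index set and
  \<open>\<delta>\<close> may vary with \<open>\<epsilon>\<close>, so deterministic estimates can be
  plugged in directly. Starting at \<open>N = 1\<close> costs nothing, since a limit ignores a
  single index.\<close>

lemma tendsto_in_prob_finite_criterion:
  assumes "\<And>\<epsilon>. \<epsilon> > 0 \<Longrightarrow> \<exists>I \<delta>. finite I \<and> \<delta> > 0 \<and>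
      (\<forall>i\<in>I. tendsto_in_prob M (\<lambda>N. X N i) (c i)) \<and>
      (\<forall>N\<ge>1. \<forall>\<omega>\<in>space M. (\<forall>i\<in>I. \<bar>X N i \<omega> - c i\<bar> \<le> \<delta>) \<longrightarrow> \<bar>Y N \<omega> - d\<bar> \<le> \<epsilon>)"
  shows "tendsto_in_prob M Y d"
  unfolding tendsto_in_prob_def
proof (intro allI impI)
  fix \<epsilon> :: real assume "\<epsilon> > 0"
  then obtain I \<delta> where I: "finite I" "\<delta> > 0"
    and X: "\<And>i. i \<in> I \<Longrightarrow> tendsto_in_prob M (\<lambda>N. X N i) (c i)"
    and Y: "\<And>N \<omega>. N \<ge> 1 \<Longrightarrow> \<omega> \<in> space M \<Longrightarrow> (\<forall>i\<in>I. \<bar>X N i \<omega> - c i\<bar> \<le> \<delta>) \<Longrightarrow> \<bar>Y N \<omega> - d\<bar> \<le> \<epsilon>"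
    using assms by metis
  let ?A = "\<lambda>N i. {\<omega> \<in> space M. \<bar>X N i \<omega> - c i\<bar> > \<delta>}"
  have "(\<lambda>N. \<Sum>i\<in>I. outer_measure_of M (?A N i)) \<longlonglongrightarrow> (\<Sum>i\<in>I. 0)"
    using X \<open>\<delta> > 0\<close> unfolding tendsto_in_prob_def by (intro tendsto_sum) blast
  then have lim: "(\<lambda>N. \<Sum>i\<in>I. outer_measure_of M (?A N i)) \<longlonglongrightarrow> 0" by simp
  show "(\<lambda>N. outer_measure_of M {\<omega> \<in> space M. \<bar>Y N \<omega> - d\<bar> > \<epsilon>}) \<longlonglongrightarrow> 0"
  proof (rule tendsto_sandwich[OF _ _ tendsto_const lim])
    show "\<forall>\<^sub>F N in sequentially. outer_measure_of M {\<omega> \<in> space M. \<bar>Y N \<omega> - d\<bar> > \<epsilon>}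
            \<le> (\<Sum>i\<in>I. outer_measure_of M (?A N i))"
      using eventually_ge_at_top[of 1]
    proof eventually_elim
      case (elim N)
      have "{\<omega> \<in> space M. \<bar>Y N \<omega> - d\<bar> > \<epsilon>} \<subseteq> (\<Union>i\<in>I. ?A N i)"
        using Y[OF elim] by fastforce
      then show ?case
        by (intro order_trans[OF outer_measure_of_mono outer_measure_of_UN_le[OF I(1)]])
    qed
  qed simp
qed

text \<open>Each point outside the support has an open null neighbourhood; by Lindelof countably
  many of these cover all such points.\<close>

lemma AE_measure_support:
  fixes \<mu> :: "'a::second_countable_topology measure"
  assumes sets_\<mu>: "sets \<mu> = sets borel"
  shows "AE x in \<mu>. x \<in> measure_support \<mu>"
proof -
  let ?F = "{U. open U \<and> emeasure \<mu> U = 0}"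
  obtain \<F> where \<F>: "\<F> \<subseteq> ?F" "countable \<F>" "\<Union>\<F> = \<Union>?F"
    using Lindelof[of ?F] by auto
  have "(\<Union>U\<in>\<F>. U) \<in> null_sets \<mu>"
    using \<F> sets_\<mu> by (intro null_sets_UN') (auto simp: null_sets_def)
  moreover have "{x \<in> space \<mu>. x \<notin> measure_support \<mu>} \<subseteq> (\<Union>U\<in>\<F>. U)"
    using \<F>(3) by (auto simp: measure_support_def zero_less_iff_neq_zero)
  ultimately show ?thesis by (intro AE_I')
qed

section \<open>Minimizers of the expected check loss\<close>

lemma check_loss_eq_max:
  "check_loss \<tau> u = max (\<tau> * u) ((\<tau> - 1) * u)"
  by (auto simp: check_loss_def max_def algebra_simps)

lemma check_loss_add_le: "check_loss \<tau> (u + v) \<le> check_loss \<tau> u + check_loss \<tau> v"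
  unfolding check_loss_eq_max distrib_left by linarith

lemma check_loss_mult: "c \<ge> 0 \<Longrightarrow> check_loss \<tau> (c * u) = c * check_loss \<tau> u"
  by (auto simp: check_loss_def mult_less_0_iff)

text \<open>Reflection swaps the slopes \<open>\<tau>\<close> and \<open>1 - \<tau>\<close>, so the
  exact factor is \<open>1 / \<tau> - 1\<close> for positive and \<open>1 / (1 - \<tau>) - 1\<close>
  for negative arguments; the constant dominates both.\<close>

lemma check_loss_uminus_le:
  assumes "0 < \<tau>" "\<tau> < 1"
  shows "check_loss \<tau> (- u) \<le> (1 / \<tau> + 1 / (1 - \<tau>)) * check_loss \<tau> u"
proof (cases "u \<ge> 0")
  case True
  then have "(1 / \<tau> + 1 / (1 - \<tau>)) * check_loss \<tau> u = u + \<tau> * u / (1 - \<tau>)"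
    using assms by (simp add: check_loss_def field_simps)
  moreover have "\<tau> * u / (1 - \<tau>) \<ge> 0" "0 \<le> \<tau> * u"
    using True assms by (auto intro: divide_nonneg_pos)
  moreover have "check_loss \<tau> (- u) = u - \<tau> * u"
    using True by (cases "u = 0") (auto simp: check_loss_def algebra_simps)
  ultimately show ?thesis by linarith
next
  case False
  then have "(1 / \<tau> + 1 / (1 - \<tau>)) * check_loss \<tau> u = - u + (1 - \<tau>) * (- u) / \<tau>"
    using assms by (simp add: check_loss_def field_simps)
  moreover have "(1 - \<tau>) * (- u) / \<tau> \<ge> 0" "(1 - \<tau>) * (- u) \<ge> 0"
    using False assms by (auto intro!: divide_nonpos_pos mult_nonneg_nonpos)
  moreover have "check_loss \<tau> (- u) = - u - (1 - \<tau>) * (- u)"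
    using False by (simp add: check_loss_def algebra_simps)
  ultimately show ?thesis by linarith
qed

text \<open>A subadditive, positively homogeneous loss is convex, its argument
  \<open>g s - u\<close> is affine in \<open>u\<close>, and integration preserves the
  inequality.\<close>

lemma convex_on_expected_check_loss:
  assumes "\<And>u. integrable \<mu> (\<lambda>s. check_loss \<tau> (g s - u))"
  shows "convex_on UNIV (expected_check_loss \<tau> \<mu> g)"
proof
  fix t x y :: real assume t: "0 < t" "t < 1"
  have "check_loss \<tau> (g s - ((1 - t) *\<^sub>R x + t *\<^sub>R y))
          \<le> (1 - t) * check_loss \<tau> (g s - x) + t * check_loss \<tau> (g s - y)" for s
  proof -
    have "g s - ((1 - t) *\<^sub>R x + t *\<^sub>R y) = (1 - t) * (g s - x) + t * (g s - y)"
      by (simp add: algebra_simps)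
    then show ?thesis
      using check_loss_add_le[of \<tau> "(1 - t) * (g s - x)" "t * (g s - y)"] t
      by (simp only: check_loss_mult)
  qed
  then have "expected_check_loss \<tau> \<mu> g ((1 - t) *\<^sub>R x + t *\<^sub>R y)
      \<le> (\<integral>s. (1 - t) * check_loss \<tau> (g s - x) + t * check_loss \<tau> (g s - y) \<partial>\<mu>)"
    unfolding expected_check_loss_def using assms by (intro integral_mono) auto
  then show "expected_check_loss \<tau> \<mu> g ((1 - t) *\<^sub>R x + t *\<^sub>R y)
      \<le> (1 - t) * expected_check_loss \<tau> \<mu> g x + t * expected_check_loss \<tau> \<mu> g y"
    unfolding expected_check_loss_def using assms by simp
qed simp

text \<open>Subadditivity applied to \<open>- u = (g s - u) + (- g s)\<close>, then integrated. The
  bound grows linearly in both directions of \<open>u\<close>, so sublevel sets of the expected loss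
  are bounded.\<close>

lemma (in prob_space) expected_check_loss_coercive:
  assumes "0 < \<tau>" "\<tau> < 1" and int: "\<And>u. integrable M (\<lambda>s. check_loss \<tau> (g s - u))"
  shows "check_loss \<tau> (- u) - (1 / \<tau> + 1 / (1 - \<tau>)) * expected_check_loss \<tau> M g 0
           \<le> expected_check_loss \<tau> M g u"
proof -
  let ?K = "1 / \<tau> + 1 / (1 - \<tau>)"
  have "check_loss \<tau> (- u) \<le> check_loss \<tau> (g s - u) + ?K * check_loss \<tau> (g s)" for s
    using check_loss_add_le[of \<tau> "g s - u" "- g s"] check_loss_uminus_le[OF assms(1,2), of "g s"]
    by (simp add: algebra_simps)
  then have "check_loss \<tau> (- u) - ?K * check_loss \<tau> (g s) \<le> check_loss \<tau> (g s - u)" for s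
    by (simp add: algebra_simps)
  then have "(\<integral>s. check_loss \<tau> (- u) - ?K * check_loss \<tau> (g s) \<partial>M)
      \<le> expected_check_loss \<tau> M g u"
    unfolding expected_check_loss_def using int[of 0] int[of u] by (intro integral_mono) auto
  then show ?thesis
    using int[of 0] by (simp add: expected_check_loss_def prob_space)
qed

text \<open>\<open>LEAST\<close> on the reals is meaningful only if a least element exists.
  Coercivity and continuity make the set of minimizers nonempty, closed and bounded below, so it
  contains its infimum.\<close>

lemma (in prob_space) is_arg_min_estimated_quantile:
  assumes "0 < \<tau>" "\<tau> < 1" and int: "\<And>u. integrable M (\<lambda>s. check_loss \<tau> (g s - u))"
  shows "is_arg_min (expected_check_loss \<tau> M g) (\<lambda>_. True) (estimated_quantile \<tau> M g)"
proof -
  define G where "G = expected_check_loss \<tau> M g"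
  \<comment> \<open>Where \<open>G u \<le> G 0\<close>, coercivity bounds
    \<open>check_loss \<tau> (- u)\<close> by the product of the first two factors; the last factor
    converts this loss into \<open>\<bar>u\<bar>\<close>.\<close>
  define R where "R = (1 + 1 / \<tau> + 1 / (1 - \<tau>)) * G 0 * (1 / \<tau> + 1 / (1 - \<tau>))"
  have cont: "continuous_on UNIV G"
    unfolding G_def by (intro convex_on_continuous open_UNIV convex_on_expected_check_loss int)
  have nonneg: "0 \<le> check_loss \<tau> u" for u
    using assms by (auto simp: check_loss_def mult_nonneg_nonneg mult_nonpos_nonpos)
  then have G0: "0 \<le> G 0" unfolding G_def expected_check_loss_def by simp
  have bound: "\<bar>u\<bar> \<le> R" if "G u \<le> G 0" for u
  proof -
    let ?K = "1 / \<tau> + 1 / (1 - \<tau>)"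
    have "check_loss \<tau> (- u) \<le> (1 + ?K) * G 0"
      using expected_check_loss_coercive[OF assms(1,2) int, of u] that
      by (simp add: G_def algebra_simps)
    then have "check_loss \<tau> (- u) * ?K \<le> R"
      unfolding R_def using assms by (intro mult_right_mono) (auto simp: algebra_simps)
    moreover have "\<bar>u\<bar> \<le> check_loss \<tau> (- u) * ?K"
    \<comment> \<open>On each side one summand of \<open>?K\<close> is the reciprocal of the active
      slope and yields \<open>\<bar>u\<bar>\<close>; the other contributes a nonnegative
      term.\<close>
    proof (cases "u \<le> 0")
      case True
      then have "check_loss \<tau> (- u) * ?K = - u + \<tau> * (- u) / (1 - \<tau>)"
        using assms by (simp add: check_loss_def field_simps)
      moreover have "\<tau> * (- u) / (1 - \<tau>) \<ge> 0"
        using True assms by (intro divide_nonneg_pos mult_nonneg_nonneg) auto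
      ultimately show ?thesis using True by linarith
    next
      case False
      then have "check_loss \<tau> (- u) * ?K = u + (1 - \<tau>) * u / \<tau>"
        using assms by (simp add: check_loss_def field_simps)
      moreover have "(1 - \<tau>) * u / \<tau> \<ge> 0"
        using False assms by (intro divide_nonneg_pos mult_nonneg_nonneg) auto
      ultimately show ?thesis using False by linarith
    qed
    ultimately show ?thesis by linarith
  qed
  have "R \<ge> 0" using bound[of 0] by simp
  then obtain u0 where u0: "u0 \<in> {-R..R}" "\<And>u. u \<in> {-R..R} \<Longrightarrow> G u0 \<le> G u"
    using continuous_attains_inf[of "{-R..R}" G] continuous_on_subset[OF cont] by auto
  \<comment> \<open>Outside \<open>{-R..R}\<close> the value exceeds \<open>G 0\<close>, which is
    itself at least \<open>G u0\<close>.\<close>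
  have u0_min: "G u0 \<le> G u" for u
    using u0(2)[of u] u0(2)[of 0] bound[of u] \<open>R \<ge> 0\<close> by fastforce
  define A where "A = {u. is_arg_min G (\<lambda>_. True) u}"
  have A_eq: "A = {u. G u \<le> G u0}"
    unfolding A_def is_arg_min_linorder using u0_min by (auto intro: order_trans)
  have "closed A"
    unfolding A_eq by (intro closed_Collect_le cont continuous_on_const)
  moreover have "A \<noteq> {}" using A_eq by auto
  moreover have bdd: "bdd_below A"
    unfolding A_eq using bound order_trans[OF _ u0_min[of 0]]
    by (intro bdd_belowI[of _ "- R"]) (simp add: abs_le_iff minus_le_iff)
  ultimately have InfA: "Inf A \<in> A" by (simp add: closed_contains_Inf)
  have "(LEAST u. u \<in> A) = Inf A"
    using InfA bdd by (intro Least_equality) (auto intro: cInf_lower)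
  then show ?thesis
    using InfA by (simp add: A_def G_def estimated_quantile_def)
qed

text \<open>Secants of \<open>G\<close> fall strictly into \<open>u\<close> and rise strictly out of
  it. The slope bounds then give \<open>F t < \<tau>\<close> to the left of \<open>u\<close> and
  \<open>F t > \<tau>\<close> to the right. The value at \<open>u\<close> stays undetermined, but
  the infimum is already fixed.\<close>

lemma (in prob_space) quantile_eq_unique_minimizer:
  assumes "0 < \<tau>" "\<tau> < 1" and int: "integrable M g"
    and min: "is_arg_min (expected_check_loss \<tau> M g) (\<lambda>_. True) u"
    and unique: "\<And>v. is_arg_min (expected_check_loss \<tau> M g) (\<lambda>_. True) v \<Longrightarrow> v = u"
  shows "quantile \<tau> M g = u"
proof -
  define G where "G = expected_check_loss \<tau> M g"
  define F where "F = (\<lambda>t. prob {s \<in> space M. g s \<le> t})"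
  have [measurable]: "g \<in> borel_measurable M" using int by simp
  have intc: "integrable M (\<lambda>s. check_loss \<tau> (g s - t))" for t
    using int unfolding check_loss_eq_max by (intro integrable_max) auto
  have ind: "integrable M (indicator {s \<in> space M. g s \<le> r} :: _ \<Rightarrow> real)" for r
    by (rule integrable_real_indicator) (simp_all add: less_top[symmetric])
  \<comment> \<open>With \<open>(t - s') * (F r - \<tau>)\<close> written as an integral, the slope
    bounds reduce to pointwise inequalities between integrands.\<close>
  have intF: "integrable M (\<lambda>s. (t - s') * (indicator {s \<in> space M. g s \<le> r} s - \<tau>))" for t s' r
    by (intro integrable_mult_right Bochner_Integration.integrable_diff ind) simp
  have valF: "(\<integral>s. (t - s') * (indicator {s \<in> space M. g s \<le> r} s - \<tau>) \<partial>M) = (t - s') * (F r - \<tau>)"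
    for t s' r :: real
    by (subst integral_mult_right_zero, subst Bochner_Integration.integral_diff[OF ind])
       (simp_all add: F_def prob_space)
  \<comment> \<open>A point with value at most \<open>G u\<close> would be a second
    minimizer.\<close>
  have G_less: "G u < G t" if "t \<noteq> u" for t
    using min unique[of t] that unfolding G_def is_arg_min_linorder
    by (metis linorder_not_less order_trans)
  have slope: "(t - s') * (F s' - \<tau>) \<le> G t - G s'" "G t - G s' \<le> (t - s') * (F t - \<tau>)"
    if "s' < t" for s' t
  proof -
    have eq: "G t - G s' = (\<integral>s. check_loss \<tau> (g s - t) - check_loss \<tau> (g s - s') \<partial>M)"
      unfolding G_def expected_check_loss_def using intc by simp
    \<comment> \<open>As the argument moves from \<open>s'\<close> to \<open>t\<close>, the loss
      changes at rate \<open>- \<tau>\<close> before it passes \<open>g s\<close> and at rate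
      \<open>1 - \<tau>\<close> afterwards. The indicator of \<open>g s \<le> s'\<close> gives the
      lowest possible average rate, that of \<open>g s \<le> t\<close> the highest.\<close>
    show "(t - s') * (F s' - \<tau>) \<le> G t - G s'"
      unfolding eq valF[symmetric] using that
      by (intro integral_mono intF Bochner_Integration.integrable_diff intc)
         (auto simp: check_loss_def indicator_def algebra_simps)
    show "G t - G s' \<le> (t - s') * (F t - \<tau>)"
      unfolding eq valF[symmetric] using that
      by (intro integral_mono intF Bochner_Integration.integrable_diff intc)
         (auto simp: check_loss_def indicator_def algebra_simps)
  qed
  have lower: "u \<le> t" if "\<tau> \<le> F t" for t
  proof (rule ccontr)
    assume "\<not> u \<le> t"
    then have "0 \<le> (u - t) * (F t - \<tau>)" using that by simp
    then show False using slope(1)[of t u] G_less[of t] \<open>\<not> u \<le> t\<close> by simp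
  qed
  have upper: "\<tau> \<le> F t" if "u < t" for t
  proof -
    have "0 < (t - u) * (F t - \<tau>)" using slope(2)[OF that] G_less[of t] that by simp
    then show ?thesis using that by (simp add: zero_less_mult_iff)
  qed
  have "Inf {t. \<tau> \<le> F t} = u"
  proof (rule antisym)
    have bdd: "bdd_below {t. \<tau> \<le> F t}" using lower by (intro bdd_belowI[of _ u]) auto
    show "Inf {t. \<tau> \<le> F t} \<le> u"
      by (rule dense_ge) (auto intro!: cInf_lower bdd upper)
    show "u \<le> Inf {t. \<tau> \<le> F t}"
      using lower upper[of "u + 1"] by (intro cInf_greatest) auto
  qed
  then show ?thesis by (simp add: quantile_def F_def)
qed

text \<open>If \<open>v\<close> were farther away, one of \<open>u - \<epsilon>\<close> and
  \<open>u + \<epsilon>\<close> would lie between \<open>u\<close> and \<open>v\<close>, where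
  convexity bounds \<open>H\<close> by \<open>max (H u) (H v) = H u\<close>.\<close>

lemma convex_on_minimizer_near:
  fixes H :: "real \<Rightarrow> real"
  assumes "convex_on UNIV H" and "H u < H (u - \<epsilon>)" "H u < H (u + \<epsilon>)"
    and "is_arg_min H (\<lambda>_. True) v" and "\<epsilon> > 0"
  shows "\<bar>v - u\<bar> \<le> \<epsilon>"
proof (rule ccontr)
  have between: "H b \<le> max (H a) (H c)" if "b \<in> closed_segment a c" for a b c
    using that convex_lower[OF assms(1)] by (auto simp: closed_segment_def)
  have "H v \<le> H u" using assms(4) by (simp add: is_arg_min_linorder)
  assume "\<not> \<bar>v - u\<bar> \<le> \<epsilon>"
  then consider "u + \<epsilon> \<in> closed_segment u v" | "u - \<epsilon> \<in> closed_segment u v"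
    using \<open>\<epsilon> > 0\<close> by (auto simp: closed_segment_eq_real_ivl abs_if split: if_splits)
  then show False
    using between[of _ u v] assms(2,3) \<open>H v \<le> H u\<close> by cases fastforce+
qed

lemma estimated_quantile_tendsto_in_prob:
  fixes \<mu> :: "nat \<Rightarrow> 'w \<Rightarrow> 'x measure"
  assumes \<tau>: "0 < \<tau>" "\<tau> < 1"
    and \<mu>: "\<And>N \<omega>. 1 \<le> N \<Longrightarrow> \<omega> \<in> space M \<Longrightarrow> prob_space (\<mu> N \<omega>)"
    and int: "\<And>N \<omega> u. 1 \<le> N \<Longrightarrow> \<omega> \<in> space M \<Longrightarrow> integrable (\<mu> N \<omega>) (\<lambda>s. check_loss \<tau> (g s - u))"
    and lim: "\<And>u. tendsto_in_prob M (\<lambda>N \<omega>. expected_check_loss \<tau> (\<mu> N \<omega>) g u) (G u)"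
    and min: "\<And>v. v \<noteq> u \<Longrightarrow> G u < G v"
  shows "tendsto_in_prob M (\<lambda>N \<omega>. estimated_quantile \<tau> (\<mu> N \<omega>) g) u"
proof (rule tendsto_in_prob_finite_criterion
    [where X = "\<lambda>N v \<omega>. expected_check_loss \<tau> (\<mu> N \<omega>) g v" and c = G])
  fix \<epsilon> :: real assume "\<epsilon> > 0"
  \<comment> \<open>A third of the smaller gap: the errors at \<open>u\<close> and at a neighbouring
    point use up at most two thirds, so the strict inequality survives.\<close>
  define \<delta> where "\<delta> = min (G (u - \<epsilon>) - G u) (G (u + \<epsilon>) - G u) / 3"
  have "\<delta> > 0" using min[of "u - \<epsilon>"] min[of "u + \<epsilon>"] \<open>\<epsilon> > 0\<close> by (simp add: \<delta>_def)
  have "\<bar>estimated_quantile \<tau> (\<mu> N \<omega>) g - u\<bar> \<le> \<epsilon>"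
    if N: "1 \<le> N" "\<omega> \<in> space M"
      and near: "\<forall>v\<in>{u - \<epsilon>, u, u + \<epsilon>}. \<bar>expected_check_loss \<tau> (\<mu> N \<omega>) g v - G v\<bar> \<le> \<delta>" for N \<omega>
  proof (rule convex_on_minimizer_near)
    interpret prob_space "\<mu> N \<omega>" using \<mu> N .
    show "convex_on UNIV (expected_check_loss \<tau> (\<mu> N \<omega>) g)"
      by (intro convex_on_expected_check_loss int N)
    show "is_arg_min (expected_check_loss \<tau> (\<mu> N \<omega>) g) (\<lambda>_. True) (estimated_quantile \<tau> (\<mu> N \<omega>) g)"
      by (intro is_arg_min_estimated_quantile \<tau> int N)
    have "3 * \<delta> \<le> G (u - \<epsilon>) - G u" "3 * \<delta> \<le> G (u + \<epsilon>) - G u" by (auto simp: \<delta>_def)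
    then show "expected_check_loss \<tau> (\<mu> N \<omega>) g u < expected_check_loss \<tau> (\<mu> N \<omega>) g (u - \<epsilon>)"
      "expected_check_loss \<tau> (\<mu> N \<omega>) g u < expected_check_loss \<tau> (\<mu> N \<omega>) g (u + \<epsilon>)"
      using near \<open>\<delta> > 0\<close> by (auto simp: abs_le_iff)
  qed fact
  then show "\<exists>I \<delta>. finite I \<and> \<delta> > 0 \<and>
      (\<forall>v\<in>I. tendsto_in_prob M (\<lambda>N \<omega>. expected_check_loss \<tau> (\<mu> N \<omega>) g v) (G v)) \<and>
      (\<forall>N\<ge>1. \<forall>\<omega>\<in>space M. (\<forall>v\<in>I. \<bar>expected_check_loss \<tau> (\<mu> N \<omega>) g v - G v\<bar> \<le> \<delta>)
         \<longrightarrow> \<bar>estimated_quantile \<tau> (\<mu> N \<omega>) g - u\<bar> \<le> \<epsilon>)"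
    using lim \<open>\<delta> > 0\<close> by (intro exI[of _ "{u - \<epsilon>, u, u + \<epsilon>}"] exI[of _ \<delta>]) blast
qed

section \<open>Stability of minimization over a compact set\<close>

lemma powr_modulus:
  fixes L a \<epsilon> :: real
  assumes "L > 0" "a > 0" "\<epsilon> > 0"
  obtains \<delta> where "\<delta> > 0" "\<And>t. 0 \<le> t \<Longrightarrow> t < \<delta> \<Longrightarrow> L * t powr a < \<epsilon>"
proof
  \<comment> \<open>The witness solves \<open>L * t powr a = \<epsilon>\<close> for
    \<open>t\<close>.\<close>
  show "(\<epsilon> / L) powr (1 / a) > 0" using assms by simp
  fix t assume t: "0 \<le> t" "t < (\<epsilon> / L) powr (1 / a)"
  then have "t powr a < ((\<epsilon> / L) powr (1 / a)) powr a"
    using assms by (intro powr_less_mono2) auto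
  then show "L * t powr a < \<epsilon>" using assms by (simp add: powr_powr field_simps)
qed

lemma hoelder_continuous_on:
  fixes g :: "'a::real_normed_vector \<Rightarrow> real"
  assumes "a > 0" "L > 0" and g: "\<forall>x\<in>X. \<forall>y\<in>X. \<bar>g x - g y\<bar> \<le> L * norm (x - y) powr a"
  shows "continuous_on X g"
  unfolding continuous_on_iff
proof (intro ballI allI impI)
  fix x \<epsilon> assume x: "x \<in> X" "0 < (\<epsilon>::real)"
  obtain \<delta> where \<delta>: "\<delta> > 0" "\<And>t. 0 \<le> t \<Longrightarrow> t < \<delta> \<Longrightarrow> L * t powr a < \<epsilon>"
    using powr_modulus[OF \<open>L > 0\<close> \<open>a > 0\<close> x(2)] by blast
  have "\<bar>g y - g x\<bar> < \<epsilon>" if "y \<in> X" "norm (y - x) < \<delta>" for y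
    using g x(1) \<delta>(2)[OF norm_ge_zero that(2)] that(1) by (meson le_less_trans)
  then show "\<exists>d>0. \<forall>x'\<in>X. dist x' x < d \<longrightarrow> dist (g x') (g x) < \<epsilon>"
    using \<delta>(1) by (auto simp: dist_norm)
qed

text \<open>A three-term estimate through a nearby net point: the modulus of \<open>k\<close>, the
  uniform continuity of \<open>g\<close>, and the closeness on the net each cost
  \<open>\<epsilon> / 3\<close>. The net is chosen before \<open>k\<close>, so one net serves all
  sample sizes and outcomes.\<close>

lemma uniformly_close_from_finite_net:
  fixes g :: "'a::real_normed_vector \<Rightarrow> real"
  assumes "compact X" "continuous_on X g" "b > 0" "L > 0" "\<epsilon> > 0"
  obtains I where "finite I" "I \<subseteq> X"
    "\<And>k x. (\<forall>x\<in>X. \<forall>y\<in>X. \<bar>k x - k y\<bar> \<le> L * norm (x - y) powr b) \<Longrightarrow>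
       (\<forall>x\<in>I. \<bar>k x - g x\<bar> \<le> \<epsilon> / 3) \<Longrightarrow> x \<in> X \<Longrightarrow> \<bar>k x - g x\<bar> \<le> \<epsilon>"
proof -
  obtain \<delta>1 where \<delta>1: "\<delta>1 > 0" "\<And>t. 0 \<le> t \<Longrightarrow> t < \<delta>1 \<Longrightarrow> L * t powr b < \<epsilon> / 3"
    using powr_modulus[of L b "\<epsilon> / 3"] assms by auto
  have "uniformly_continuous_on X g"
    using assms by (intro compact_uniformly_continuous)
  then obtain \<delta>2 where \<delta>2: "\<delta>2 > 0"
    "\<And>x y. x \<in> X \<Longrightarrow> y \<in> X \<Longrightarrow> dist y x < \<delta>2 \<Longrightarrow> dist (g y) (g x) < \<epsilon> / 3"
    using \<open>\<epsilon> > 0\<close> unfolding uniformly_continuous_on_def by (metis divide_pos_pos zero_less_numeral)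
  have "X \<subseteq> (\<Union>x\<in>X. ball x (min \<delta>1 \<delta>2))" using \<delta>1 \<delta>2 by auto
  then obtain I where I: "I \<subseteq> X" "finite I" "X \<subseteq> (\<Union>x\<in>I. ball x (min \<delta>1 \<delta>2))"
    by (rule compactE_image[OF assms(1) open_ball])
  show ?thesis
  proof (rule that[of I])
    fix k x assume k: "\<forall>x\<in>X. \<forall>y\<in>X. \<bar>k x - k y\<bar> \<le> L * norm (x - y) powr b"
      and kg: "\<forall>x\<in>I. \<bar>k x - g x\<bar> \<le> \<epsilon> / 3" and x: "x \<in> X"
    obtain y where y: "y \<in> I" "dist y x < \<delta>1" "dist y x < \<delta>2" using I x by auto
    have "\<bar>k y - k x\<bar> \<le> L * norm (y - x) powr b" using k I y x by blast
    also have "\<dots> < \<epsilon> / 3" using \<delta>1(2) y by (simp add: dist_norm)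
    finally have "\<bar>k y - k x\<bar> < \<epsilon> / 3" .
    moreover have "\<bar>g y - g x\<bar> < \<epsilon> / 3" using \<delta>2(2)[of x y] I y x by (auto simp: dist_real_def)
    moreover have "\<bar>k y - g y\<bar> \<le> \<epsilon> / 3" using kg y by blast
    ultimately show "\<bar>k x - g x\<bar> \<le> \<epsilon>" by linarith
  qed (use I in auto)
qed

section \<open>Minimum values and solution sets\<close>

lemma opt_value_attained:
  fixes g :: "'a::topological_space \<Rightarrow> real"
  assumes "compact X" "X \<noteq> {}" "continuous_on X g"
  shows "\<And>x. x \<in> X \<Longrightarrow> opt_value X g \<le> g x"
    and "opt_solutions X g \<noteq> {}"
    and "opt_solutions X g = {x \<in> X. g x = opt_value X g}"
proof -
  obtain x0 where x0: "x0 \<in> X" "\<And>x. x \<in> X \<Longrightarrow> g x0 \<le> g x"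
    using continuous_attains_inf[OF assms] by auto
  have opt: "opt_value X g = g x0"
    unfolding opt_value_def using x0 by (intro cInf_eq_minimum) auto
  then show "opt_value X g \<le> g x" if "x \<in> X" for x using x0 that by simp
  show eq: "opt_solutions X g = {x \<in> X. g x = opt_value X g}"
    unfolding opt opt_solutions_def is_arg_min_linorder using x0 by (auto intro: antisym)
  then show "opt_solutions X g \<noteq> {}" using x0 opt by auto
qed

text \<open>Removing the open \<open>\<epsilon>\<close>-balls around the solutions leaves a compact
  set without solutions. If it is nonempty, the minimum of \<open>g\<close> there lies strictly
  above the optimal value.\<close>

lemma near_minimizers_near_opt_solutions:
  fixes g :: "'a::real_normed_vector \<Rightarrow> real"
  assumes "compact X" "X \<noteq> {}" "continuous_on X g" "\<epsilon> > 0"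
  obtains \<delta> where "\<delta> > 0"
    "\<And>x. x \<in> X \<Longrightarrow> g x \<le> opt_value X g + \<delta> \<Longrightarrow> \<exists>y\<in>opt_solutions X g. norm (x - y) \<le> \<epsilon>"
proof -
  note opt = opt_value_attained[OF assms(1-3)]
  let ?K = "X - (\<Union>y\<in>opt_solutions X g. ball y \<epsilon>)"
  have near: "\<exists>y\<in>opt_solutions X g. norm (x - y) \<le> \<epsilon>" if "x \<in> X" "x \<notin> ?K" for x
    using that by (force simp: dist_norm norm_minus_commute)
  show ?thesis
  proof (cases "?K = {}")
    case True
    show ?thesis
    proof (rule that[of 1])
      show "\<exists>y\<in>opt_solutions X g. norm (x - y) \<le> \<epsilon>" if "x \<in> X" for x
        using near[OF that] unfolding True by simp
    qed simp
  next
    case False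
    have K: "compact ?K" using assms(1) by (intro compact_diff open_UN ballI open_ball)
    have "continuous_on ?K g" using assms(3) by (rule continuous_on_subset) auto
    then obtain x0 where x0: "x0 \<in> ?K" "\<And>x. x \<in> ?K \<Longrightarrow> g x0 \<le> g x"
      using continuous_attains_inf[OF K False] by metis
    have "x0 \<notin> opt_solutions X g" using x0(1) \<open>\<epsilon> > 0\<close> by auto
    then have gap: "opt_value X g < g x0" using x0(1) opt(1)[of x0] opt(3) by force
    show ?thesis
    \<comment> \<open>Half the gap keeps \<open>g x\<close> strictly below \<open>g x0\<close>, so
      \<open>x\<close> cannot belong to \<open>?K\<close>.\<close>
    proof (rule that[of "(g x0 - opt_value X g) / 2"])
      fix x assume x: "x \<in> X" "g x \<le> opt_value X g + (g x0 - opt_value X g) / 2"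
      then have "\<not> g x0 \<le> g x" using gap by (simp add: field_simps)
      then have "x \<notin> ?K" using x0(2) by blast
      then show "\<exists>y\<in>opt_solutions X g. norm (x - y) \<le> \<epsilon>" using near x by blast
    qed (use gap in simp)
  qed
qed

text \<open>Each function is tested at a minimizer of the other. For solutions the error doubles:
  one \<open>\<delta>\<close> for exchanging \<open>k\<close> and \<open>g\<close> at the point, one
  for exchanging the optimal values.\<close>

lemma opt_solutions_perturbation:
  fixes g k :: "'a::topological_space \<Rightarrow> real"
  assumes "compact X" "X \<noteq> {}" "continuous_on X g" "continuous_on X k"
    and close: "\<And>x. x \<in> X \<Longrightarrow> \<bar>k x - g x\<bar> \<le> \<delta>"
  shows "\<bar>opt_value X k - opt_value X g\<bar> \<le> \<delta>"
    and "x \<in> opt_solutions X k \<Longrightarrow> x \<in> X \<and> g x \<le> opt_value X g + 2 * \<delta>"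
    and "\<bar>(SUP x\<in>opt_solutions X k. g x) - opt_value X g\<bar> \<le> 2 * \<delta>"
proof -
  note g = opt_value_attained[OF assms(1-3)] and k = opt_value_attained[OF assms(1,2,4)]
  obtain x y where x: "x \<in> X" "g x = opt_value X g" and y: "y \<in> X" "k y = opt_value X k"
    using g(2,3) k(2,3) by blast
  show val: "\<bar>opt_value X k - opt_value X g\<bar> \<le> \<delta>"
    using close[OF x(1)] close[OF y(1)] k(1)[OF x(1)] g(1)[OF y(1)] x y by linarith
  show sol: "x \<in> X \<and> g x \<le> opt_value X g + 2 * \<delta>" if "x \<in> opt_solutions X k" for x
    using that close[of x] val unfolding k(3) by fastforce
  \<comment> \<open>A single solution \<open>y\<close> of \<open>k\<close> bounds the supremum from
    below; \<open>sol\<close> supplies the boundedness without which a real \<open>SUP\<close> says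
    nothing.\<close>
  have "opt_value X g \<le> (SUP x\<in>opt_solutions X k. g x)"
  proof (rule cSUP_upper2)
    show "y \<in> opt_solutions X k" using y k(3) by simp
    show "opt_value X g \<le> g y" using g(1) y by simp
    show "bdd_above (g ` opt_solutions X k)" using sol by (intro bdd_aboveI2) blast
  qed
  moreover have "(SUP x\<in>opt_solutions X k. g x) \<le> opt_value X g + 2 * \<delta>"
    using sol by (intro cSUP_least k(2)) blast
  ultimately show "\<bar>(SUP x\<in>opt_solutions X k. g x) - opt_value X g\<bar> \<le> 2 * \<delta>" by simp
qed

text \<open>The witnesses in \<open>S'\<close> and the nonemptiness of \<open>S\<close> ensure that
  the inner \<open>INF\<close> and the outer \<open>SUP\<close> are over nonempty bounded
  sets.\<close>

lemma set_deviation_bounds: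
  assumes "S \<noteq> {}" "\<And>x. x \<in> S \<Longrightarrow> \<exists>y\<in>S'. norm (x - y) \<le> \<epsilon>"
  shows "\<bar>set_deviation S S'\<bar> \<le> \<epsilon>"
proof -
  have inf: "0 \<le> (INF y\<in>S'. norm (x - y)) \<and> (INF y\<in>S'. norm (x - y)) \<le> \<epsilon>" if "x \<in> S" for x
  proof -
    obtain y where y: "y \<in> S'" "norm (x - y) \<le> \<epsilon>" using assms(2) \<open>x \<in> S\<close> by blast
    then have "(INF y\<in>S'. norm (x - y)) \<le> \<epsilon>"
      by (intro cINF_lower2[of _ _ y] bdd_belowI2[of _ 0]) auto
    moreover have "0 \<le> (INF y\<in>S'. norm (x - y))" using y by (intro cINF_greatest) auto
    ultimately show ?thesis by simp
  qed
  have "set_deviation S S' \<le> \<epsilon>"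
    unfolding set_deviation_def using inf by (intro cSUP_least assms(1)) blast
  moreover have "0 \<le> set_deviation S S'"
  proof -
    obtain x where "x \<in> S" using assms(1) by blast
    then show ?thesis
      unfolding set_deviation_def using inf by (intro cSUP_upper2[of _ _ x] bdd_aboveI2) auto
  qed
  ultimately show ?thesis by simp
qed

lemma opt_tendsto_in_prob:
  fixes g :: "'a::real_normed_vector \<Rightarrow> real" and k :: "nat \<Rightarrow> 'w \<Rightarrow> 'a \<Rightarrow> real"
  assumes "compact X" "X \<noteq> {}" and cont: "continuous_on X g" and "b > 0" "L > 0"
    and hoelder: "\<forall>N\<ge>1. \<forall>\<omega>\<in>space M. \<forall>x\<in>X. \<forall>y\<in>X. \<bar>k N \<omega> x - k N \<omega> y\<bar> \<le> L * norm (x - y) powr b"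
    and lim: "\<And>x. x \<in> X \<Longrightarrow> tendsto_in_prob M (\<lambda>N \<omega>. k N \<omega> x) (g x)"
  shows "tendsto_in_prob M (\<lambda>N \<omega>. opt_value X (k N \<omega>)) (opt_value X g)"
    and "tendsto_in_prob M (\<lambda>N \<omega>. SUP x\<in>opt_solutions X (k N \<omega>). g x) (opt_value X g)"
    and "tendsto_in_prob M (\<lambda>N \<omega>. set_deviation (opt_solutions X (k N \<omega>)) (opt_solutions X g)) 0"
proof -
  have k_cont: "continuous_on X (k N \<omega>)" if "N \<ge> 1" "\<omega> \<in> space M" for N \<omega>
    using hoelder_continuous_on[OF \<open>b > 0\<close> \<open>L > 0\<close>] hoelder that by blast
  \<comment> \<open>The common modulus and a finite net remove the probability: what remains for
    each claim is a deterministic consequence of uniform closeness.\<close>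
  have criterion: "tendsto_in_prob M Y d"
    if Y: "\<And>\<epsilon>. \<epsilon> > 0 \<Longrightarrow> \<exists>\<delta>>0. \<forall>N\<ge>1. \<forall>\<omega>\<in>space M.
             (\<forall>x\<in>X. \<bar>k N \<omega> x - g x\<bar> \<le> \<delta>) \<longrightarrow> \<bar>Y N \<omega> - d\<bar> \<le> \<epsilon>" for Y d
  proof (rule tendsto_in_prob_finite_criterion[where X = "\<lambda>N x \<omega>. k N \<omega> x" and c = g])
    fix \<epsilon> :: real assume "\<epsilon> > 0"
    then obtain \<delta> where \<delta>: "\<delta> > 0" "\<And>N \<omega>. N \<ge> 1 \<Longrightarrow> \<omega> \<in> space M \<Longrightarrow>
        \<forall>x\<in>X. \<bar>k N \<omega> x - g x\<bar> \<le> \<delta> \<Longrightarrow> \<bar>Y N \<omega> - d\<bar> \<le> \<epsilon>"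
      using Y by metis
    obtain I where I: "finite I" "I \<subseteq> X" "\<And>k x. (\<forall>x\<in>X. \<forall>y\<in>X. \<bar>k x - k y\<bar> \<le> L * norm (x - y) powr b) \<Longrightarrow>
       (\<forall>x\<in>I. \<bar>k x - g x\<bar> \<le> \<delta> / 3) \<Longrightarrow> x \<in> X \<Longrightarrow> \<bar>k x - g x\<bar> \<le> \<delta>"
      using uniformly_close_from_finite_net[OF assms(1) cont assms(4,5) \<delta>(1)] by blast
    have "\<bar>Y N \<omega> - d\<bar> \<le> \<epsilon>" if "N \<ge> 1" "\<omega> \<in> space M" "\<forall>x\<in>I. \<bar>k N \<omega> x - g x\<bar> \<le> \<delta> / 3" for N \<omega>
      using \<delta>(2) I(3)[of "k N \<omega>"] that hoelder by blast
    then show "\<exists>I \<delta>. finite I \<and> \<delta> > 0 \<and> (\<forall>x\<in>I. tendsto_in_prob M (\<lambda>N \<omega>. k N \<omega> x) (g x)) \<and>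
      (\<forall>N\<ge>1. \<forall>\<omega>\<in>space M. (\<forall>x\<in>I. \<bar>k N \<omega> x - g x\<bar> \<le> \<delta>) \<longrightarrow> \<bar>Y N \<omega> - d\<bar> \<le> \<epsilon>)"
      using I \<delta>(1) lim by (intro exI[of _ I] exI[of _ "\<delta> / 3"]) auto
  qed
  show "tendsto_in_prob M (\<lambda>N \<omega>. opt_value X (k N \<omega>)) (opt_value X g)"
    using opt_solutions_perturbation(1)[OF assms(1,2) cont k_cont] by (intro criterion) blast
  show "tendsto_in_prob M (\<lambda>N \<omega>. SUP x\<in>opt_solutions X (k N \<omega>). g x) (opt_value X g)"
  proof (rule criterion)
    fix \<epsilon> :: real assume "\<epsilon> > 0"
    moreover have "\<bar>(SUP x\<in>opt_solutions X (k N \<omega>). g x) - opt_value X g\<bar> \<le> \<epsilon>"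
      if "N \<ge> 1" "\<omega> \<in> space M" "\<forall>x\<in>X. \<bar>k N \<omega> x - g x\<bar> \<le> \<epsilon> / 2" for N \<omega>
      using opt_solutions_perturbation(3)[OF assms(1,2) cont k_cont, of N \<omega> "\<epsilon> / 2"] that by simp
    ultimately show "\<exists>\<delta>>0. \<forall>N\<ge>1. \<forall>\<omega>\<in>space M. (\<forall>x\<in>X. \<bar>k N \<omega> x - g x\<bar> \<le> \<delta>) \<longrightarrow>
        \<bar>(SUP x\<in>opt_solutions X (k N \<omega>). g x) - opt_value X g\<bar> \<le> \<epsilon>"
      by (intro exI[of _ "\<epsilon> / 2"]) auto
  qed
  show "tendsto_in_prob M (\<lambda>N \<omega>. set_deviation (opt_solutions X (k N \<omega>)) (opt_solutions X g)) 0"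
  proof (rule criterion)
    fix \<epsilon> :: real assume "\<epsilon> > 0"
    then obtain \<delta> where \<delta>: "\<delta> > 0"
      "\<And>x. x \<in> X \<Longrightarrow> g x \<le> opt_value X g + \<delta> \<Longrightarrow> \<exists>y\<in>opt_solutions X g. norm (x - y) \<le> \<epsilon>"
      using near_minimizers_near_opt_solutions[OF assms(1,2) cont] by metis
    \<comment> \<open>With closeness \<open>\<delta> / 2\<close>, solutions for
      \<open>k N \<omega>\<close> are optimal for \<open>g\<close> up to \<open>\<delta>\<close>, as
      the choice of \<open>\<delta>\<close> requires.\<close>
    have "\<bar>set_deviation (opt_solutions X (k N \<omega>)) (opt_solutions X g)\<bar> \<le> \<epsilon>"
      if "N \<ge> 1" "\<omega> \<in> space M" "\<forall>x\<in>X. \<bar>k N \<omega> x - g x\<bar> \<le> \<delta> / 2" for N \<omega>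
    proof (rule set_deviation_bounds)
      show "opt_solutions X (k N \<omega>) \<noteq> {}"
        using opt_value_attained(2)[OF assms(1,2) k_cont] that by blast
      show "\<exists>y\<in>opt_solutions X g. norm (x - y) \<le> \<epsilon>" if "x \<in> opt_solutions X (k N \<omega>)" for x
        using opt_solutions_perturbation(2)[OF assms(1,2) cont k_cont, of N \<omega> "\<delta> / 2" x] \<delta>(2)[of x]
          that \<open>N \<ge> 1\<close> \<open>\<omega> \<in> space M\<close> \<open>\<forall>x\<in>X. \<bar>k N \<omega> x - g x\<bar> \<le> \<delta> / 2\<close> by simp
    qed
    then show "\<exists>\<delta>>0. \<forall>N\<ge>1. \<forall>\<omega>\<in>space M. (\<forall>x\<in>X. \<bar>k N \<omega> x - g x\<bar> \<le> \<delta>) \<longrightarrow>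
        \<bar>set_deviation (opt_solutions X (k N \<omega>)) (opt_solutions X g) - 0\<bar> \<le> \<epsilon>"
      using \<delta>(1) by (intro exI[of _ "\<delta> / 2"]) auto
  qed
qed

section \<open>Consistency of the sample problem for almost every \<open>z\<close>\<close>

theorem theorem5:
  fixes X :: "(real^'n) set"
    and \<tau> :: real
    and q :: "real^'m"
    and T :: "real^'n^'r" and W :: "real^'m^'r" and C :: "real^'l^'r" and h :: "real^'r"
    and P :: "'a measure"
    and Z :: "'a \<Rightarrow> real^'p" and \<xi> :: "'a \<Rightarrow> real^'l"
    and \<kappa> :: "real^'p \<Rightarrow> (real^'l) measure"
    and M :: "'w measure"
    and Zs :: "nat \<Rightarrow> 'w \<Rightarrow> real^'p" and \<xi>s :: "nat \<Rightarrow> 'w \<Rightarrow> real^'l"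
    and Phat :: "nat \<Rightarrow> ((real^'p) \<times> (real^'l)) list \<Rightarrow> real^'p \<Rightarrow> (real^'l) measure"
  defines "PZ \<equiv> distr P borel Z"
    and "\<Xi> \<equiv> measure_support (distr P borel \<xi>)"
    and "f \<equiv> recourse_cost q T W C h"
    and "Ph \<equiv> \<lambda>N \<omega> z. Phat N (sample_data Zs \<xi>s N \<omega>) z"
  defines "Q \<equiv> \<lambda>z x. quantile \<tau> (\<kappa> z) (f x)"
    and "Qhat \<equiv> \<lambda>N \<omega> z x. estimated_quantile \<tau> (Ph N \<omega> z) (f x)"
  assumes "X \<noteq> {}" and "0 < \<tau>" and "\<tau> < 1"
    \<comment> \<open>the random vectors and the conditional distribution\<close>
    and "prob_space P" and "Z \<in> borel_measurable P" and "\<xi> \<in> borel_measurable P"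
    and "is_cond_distribution P Z \<xi> \<kappa>"
    \<comment> \<open>the second-stage problem\<close>
    and "\<And>x s. x \<in> X \<Longrightarrow> s \<in> \<Xi> \<Longrightarrow> recourse_optimal q T W C h x s \<noteq> {}"
    and "\<And>x s. x \<in> X \<Longrightarrow> s \<in> \<Xi> \<Longrightarrow> 0 < f x s"
    \<comment> \<open>the samples\<close>
    and "prob_space M"
    and "\<And>i. 1 \<le> i \<Longrightarrow> Zs i \<in> borel_measurable M"
    and "\<And>i. 1 \<le> i \<Longrightarrow> \<xi>s i \<in> borel_measurable M"
    and "\<And>i. 1 \<le> i \<Longrightarrow>
           distr M borel (\<lambda>\<omega>. (Zs i \<omega>, \<xi>s i \<omega>)) = distr P borel (\<lambda>\<omega>. (Z \<omega>, \<xi> \<omega>))"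
    \<comment> \<open>the estimates of the conditional distribution\<close>
    and "\<And>N \<omega> z. 1 \<le> N \<Longrightarrow> \<omega> \<in> space M \<Longrightarrow> z \<in> measure_support PZ \<Longrightarrow>
           prob_space (Ph N \<omega> z) \<and> sets (Ph N \<omega> z) = sets borel \<and> measure (Ph N \<omega> z) \<Xi> = 1"
    and "\<And>N \<omega> z x u. 1 \<le> N \<Longrightarrow> \<omega> \<in> space M \<Longrightarrow> z \<in> measure_support PZ \<Longrightarrow> x \<in> X \<Longrightarrow>
           integrable (Ph N \<omega> z) (\<lambda>s. check_loss \<tau> (f x s - u))"
    and A1: "compact X"
    and A2: "AE z in PZ. \<forall>x\<in>X. integrable (\<kappa> z) (f x) \<and>
               (\<exists>!u. is_arg_min (expected_check_loss \<tau> (\<kappa> z) (f x)) (\<lambda>_. True) u)"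
    and A3: "AE z in PZ.
               (\<exists>\<alpha>>0. \<exists>L\<^sub>1>0. \<forall>x\<^sub>1\<in>X. \<forall>x\<^sub>2\<in>X.
                  \<bar>Q z x\<^sub>1 - Q z x\<^sub>2\<bar> \<le> L\<^sub>1 * norm (x\<^sub>1 - x\<^sub>2) powr \<alpha>) \<and>
               (\<exists>\<beta>>0. \<exists>L\<^sub>2>0. \<forall>N\<ge>1. \<forall>\<omega>\<in>space M. \<forall>x\<^sub>1\<in>X. \<forall>x\<^sub>2\<in>X.
                  \<bar>Qhat N \<omega> z x\<^sub>1 - Qhat N \<omega> z x\<^sub>2\<bar> \<le> L\<^sub>2 * norm (x\<^sub>1 - x\<^sub>2) powr \<beta>)"
    and A4: "AE z in PZ.
               (\<exists>B. compact B \<and> B \<subseteq> \<Xi> \<and> 0 < measure (\<kappa> z) B) \<and>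
               (\<forall>x\<in>X. \<forall>u. tendsto_in_prob M
                  (\<lambda>N \<omega>. expected_check_loss \<tau> (Ph N \<omega> z) (f x) u)
                  (expected_check_loss \<tau> (\<kappa> z) (f x) u)) \<and>
               (\<forall>A\<in>sets borel. A \<subseteq> \<Xi> \<longrightarrow> tendsto_in_prob M
                  (\<lambda>N \<omega>. \<integral>s. indicator A s \<partial>Ph N \<omega> z) (\<integral>s. indicator A s \<partial>\<kappa> z))"
  shows "AE z in PZ.
           tendsto_in_prob M (\<lambda>N \<omega>. opt_value X (Qhat N \<omega> z)) (opt_value X (Q z)) \<and>
           tendsto_in_prob M (\<lambda>N \<omega>. SUP x\<in>opt_solutions X (Qhat N \<omega> z). Q z x)
             (opt_value X (Q z)) \<and>
           tendsto_in_prob M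
             (\<lambda>N \<omega>. set_deviation (opt_solutions X (Qhat N \<omega> z)) (opt_solutions X (Q z))) 0"
proof -
  note \<tau> = \<open>0 < \<tau>\<close> \<open>\<tau> < 1\<close>
  have \<kappa>: "prob_space (\<kappa> z)" for z
  proof -
    have "\<kappa> \<in> borel \<rightarrow>\<^sub>M prob_algebra borel"
      using \<open>is_cond_distribution P Z \<xi> \<kappa>\<close> unfolding is_cond_distribution_def by (rule conjunct1)
    then have "\<kappa> z \<in> space (prob_algebra borel)" by (rule measurable_space) simp
    then show ?thesis by (simp add: space_prob_algebra)
  qed
  \<comment> \<open>The estimates are assumed to be probability measures with integrable losses only
    for \<open>z\<close> in the support, which holds almost everywhere.\<close>
  have "AE z in PZ. z \<in> measure_support PZ"
    by (rule AE_measure_support) (simp add: PZ_def)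
  then show ?thesis
    using A2 A3 A4
  proof eventually_elim
    case (elim z)
    interpret \<kappa>: prob_space "\<kappa> z" by (rule \<kappa>)
    have lim: "tendsto_in_prob M (\<lambda>N \<omega>. Qhat N \<omega> z x) (Q z x)" if x: "x \<in> X" for x
    proof -
      let ?G = "expected_check_loss \<tau> (\<kappa> z) (f x)"
      have int: "integrable (\<kappa> z) (f x)" and "\<exists>!u. is_arg_min ?G (\<lambda>_. True) u"
        using elim(2) x by auto
      then obtain u where u: "is_arg_min ?G (\<lambda>_. True) u"
        and unique: "\<And>v. is_arg_min ?G (\<lambda>_. True) v \<Longrightarrow> v = u"
        by auto
      have "Q z x = u"
        unfolding Q_def by (rule \<kappa>.quantile_eq_unique_minimizer[OF \<tau> int u unique])
      \<comment> \<open>Uniqueness makes the minimum strict, the form needed for the convergence of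
        the estimated quantile.\<close>
      moreover have "?G u < ?G v" if "v \<noteq> u" for v
        using u unique[of v] that unfolding is_arg_min_linorder
        by (metis linorder_not_less order_trans)
      ultimately show ?thesis
        unfolding Qhat_def using assms(20,21) elim(1,4) x
        by (intro estimated_quantile_tendsto_in_prob[where G = ?G] \<tau>) auto
    qed
    obtain a L1 where "a > 0" "L1 > 0"
      "\<forall>x\<in>X. \<forall>y\<in>X. \<bar>Q z x - Q z y\<bar> \<le> L1 * norm (x - y) powr a"
      using elim(3) by blast
    then have cont: "continuous_on X (Q z)" by (rule hoelder_continuous_on)
    \<comment> \<open>This modulus is fixed before \<open>N\<close> and \<open>\<omega>\<close>, as
      the common finite net requires.\<close>
    obtain b L2 where "b > 0" "L2 > 0" "\<forall>N\<ge>1. \<forall>\<omega>\<in>space M. \<forall>x\<in>X. \<forall>y\<in>X.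
        \<bar>Qhat N \<omega> z x - Qhat N \<omega> z y\<bar> \<le> L2 * norm (x - y) powr b"
      using elim(3) by blast
    then show ?case
      using opt_tendsto_in_prob[OF A1 \<open>X \<noteq> {}\<close> cont _ _ _ lim]
      by blast
  qed
qed

end
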